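(* Let $n,N\ge 1$ be integers, $\mathcal V=\{1,\dots,N\}$, and let $\alpha,\gamma$ be real numbers with $0<\alpha<\gamma<\infty$. For each $i\in\mathcal V$ let $f_i:\mathbb R^n\to\mathbb R$ be closed, proper, $\alpha$-semi-convex and bounded from below. Let $\rho>0$, and let $z^{[1]},y^{[1]},\lambda_1^{[1]},\dots,\lambda_N^{[1]}\in\mathbb R^n$ be arbitrary. Let $(z^{[k]})_{k\ge 1}$ be the infinite sequence of outer-level iterates generated from this initialization by the algorithm CADMM-Prox described in the context. Then $$\lim_{k\to\infty}\left\|z^{[k+1]}-z^{[k]}\right\|=0 .$$
   Context: $\|\cdot\|$ is the Euclidean norm on $\mathbb R^n$. Semi-convexity: a (possibly non-smooth) function $f:\mathbb R^n\to\mathbb R$ is $\alpha$-semi-convex ($\alpha>0$ finite) if $$f(\xi)+d^\top(\zeta-\xi)\le f(\zeta)+\frac{\alpha}{2}\|\xi-\zeta\|^2\quad\text{for all }\xi,\zeta\in\mathbb R^n\text{ and all }d\in\partial f(\xi),$$ where $\partial f$ is the (limiting) subdifferential. For $z\in\mathbb R^n$ and $i\in\mathcal V$ define $F_i^{z}(x)=f_i(x)+\frac{\gamma}{2}\|x-z\|^2$, and define $\Phi(z,y)=\sum_{i=1}^N F_i^{z}(y)$ for $z,y\in\mathbb R^n$. Algorithm CADMM-Prox. It has an outer counter $k$ and an inner counter $t$, both starting at $1$; the inner counter and the inner variables $y,\lambda_i$ are carried over (not reset) from one outer iteration to the next. Outer iteration $k$: with $z^{[k]}$ fixed, repeat the following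 inner iteration (at least once), incrementing $t$ by one after each inner iteration: 1) for every $i\in\mathcal V$, $\displaystyle x_i^{[t+1]}=\arg\min_{x_i\in\mathbb R^n}\; F_i^{z^{[k]}}(x_i)+\big(\lambda_i^{[t]}\big)^\top x_i+\frac{\rho}{2}\big\|x_i-y^{[t]}\big\|^2$; 2) $\displaystyle y^{[t+1]}=\frac1N\sum_{i=1}^N\Big(x_i^{[t+1]}+\frac{\lambda_i^{[t]}}{\rho}\Big)$; 3) for every $i\in\mathcal V$, $\lambda_i^{[t+1]}=\lambda_i^{[t]}+\rho\big(x_i^{[t+1]}-y^{[t+1]}\big)$; until the stopping criterion $$\Phi\big(z^{[k]},y^{[t+1]}\big)<\Phi\big(z^{[k]},z^{[k]}\big)$$ is satisfied. Once it is satisfied, set $z^{[k+1]}=y^{[t+1]}$ and pass to outer iteration $k+1$. (In practice the algorithm is terminated when $\|z^{[k+1]}-z^{[k]}\|<\epsilon$ for a tolerance $\epsilon>0$; for the asymptotic statement this test is disregarded and the outer iterations continue indefinitely, the inner stopping criterion being triggered at every outer iteration.) *)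

theory Defs
  imports "HOL-Analysis.Analysis"
begin

definition closed_fun :: "('a::euclidean_space \<Rightarrow> real) \<Rightarrow> bool" where
  "closed_fun f \<longleftrightarrow> closed (epigraph UNIV f)"

(* Stated for extended-real-valued functions, for which properness is a genuine
   restriction; a finite-valued f is regarded as the function ereal o f. *)
definition proper_fun :: "('a \<Rightarrow> ereal) \<Rightarrow> bool" where
  "proper_fun g \<longleftrightarrow> (\<exists>x. g x < \<infinity>) \<and> (\<forall>x. - \<infinity> < g x)"

definition frechet_subdifferential :: "('a::euclidean_space \<Rightarrow> real) \<Rightarrow> 'a \<Rightarrow> 'a set" where
  "frechet_subdifferential f x =
     {d. 0 \<le> Liminf (at x) (\<lambda>u. ereal ((f u - f x - d \<bullet> (u - x)) / norm (u - x)))}"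

(* The requirement that f (u m) tends to f x (f-attentive convergence) is part of the
   standard definition and is not redundant when f is discontinuous. *)
definition limiting_subdifferential :: "('a::euclidean_space \<Rightarrow> real) \<Rightarrow> 'a \<Rightarrow> 'a set" where
  "limiting_subdifferential f x =
     {d. \<exists>u e. u \<longlonglongrightarrow> x \<and> (\<lambda>m. f (u m)) \<longlonglongrightarrow> f x \<and> e \<longlonglongrightarrow> d \<and>
               (\<forall>m::nat. e m \<in> frechet_subdifferential f (u m))}"

definition semi_convex :: "real \<Rightarrow> ('a::euclidean_space \<Rightarrow> real) \<Rightarrow> bool" where
  "semi_convex \<alpha> f \<longleftrightarrow> 0 < \<alpha> \<and>
     (\<forall>\<xi> \<zeta>. \<forall>d \<in> limiting_subdifferential f \<xi>.
        f \<xi> + d \<bullet> (\<zeta> - \<xi>) \<le> f \<zeta> + \<alpha> / 2 * (norm (\<xi> - \<zeta>))\<^sup>2)"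

definition prox_fun :: "real \<Rightarrow> ('a::euclidean_space \<Rightarrow> real) \<Rightarrow> 'a \<Rightarrow> 'a \<Rightarrow> real" where
  "prox_fun \<gamma> g z x = g x + \<gamma> / 2 * (norm (x - z))\<^sup>2"

definition Phi :: "nat \<Rightarrow> (nat \<Rightarrow> 'a::euclidean_space \<Rightarrow> real) \<Rightarrow> real \<Rightarrow> 'a \<Rightarrow> 'a \<Rightarrow> real" where
  "Phi N f \<gamma> z y = (\<Sum>i\<in>{1..N}. prox_fun \<gamma> (f i) z y)"

(* One inner iteration, from (y, l) to (x', y', l'); l, x', l' are families indexed by
   the agents 1..N. *)
definition cadmm_inner_step ::
  "nat \<Rightarrow> (nat \<Rightarrow> 'a::euclidean_space \<Rightarrow> real) \<Rightarrow> real \<Rightarrow> real \<Rightarrow> 'a \<Rightarrow>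
   'a \<Rightarrow> (nat \<Rightarrow> 'a) \<Rightarrow> (nat \<Rightarrow> 'a) \<Rightarrow> 'a \<Rightarrow> (nat \<Rightarrow> 'a) \<Rightarrow> bool" where
  "cadmm_inner_step N f \<gamma> \<rho> z y l x' y' l' \<longleftrightarrow>
     (\<forall>i\<in>{1..N}. is_arg_min
        (\<lambda>v. prox_fun \<gamma> (f i) z v + l i \<bullet> v + \<rho> / 2 * (norm (v - y))\<^sup>2) (\<lambda>_. True) (x' i)) \<and>
     y' = (1 / real N) *\<^sub>R (\<Sum>i\<in>{1..N}. x' i + (1 / \<rho>) *\<^sub>R l i) \<and>
     (\<forall>i\<in>{1..N}. l' i = l i + \<rho> *\<^sub>R (x' i - y'))"

definition stop_criterion ::
  "nat \<Rightarrow> (nat \<Rightarrow> 'a::euclidean_space \<Rightarrow> real) \<Rightarrow> real \<Rightarrow> 'a \<Rightarrow> 'a \<Rightarrow> bool" where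
  "stop_criterion N f \<gamma> z y \<longleftrightarrow> Phi N f \<gamma> z y < Phi N f \<gamma> z z"

(* z is the sequence of outer iterates of a nonterminating run started in (z1, y1, l1).
   T k is the value of the inner counter when outer iteration k begins, so that the inner
   iterations T k, ..., T (k+1) - 1 are carried out with z k; the stopping criterion is
   tested after each of them and holds for the first time after the last one.
   Counters start at 1; the values of all sequences at index 0 are irrelevant. *)
definition cadmm_prox_run ::
  "nat \<Rightarrow> (nat \<Rightarrow> 'a::euclidean_space \<Rightarrow> real) \<Rightarrow> real \<Rightarrow> real \<Rightarrow>
   'a \<Rightarrow> 'a \<Rightarrow> (nat \<Rightarrow> 'a) \<Rightarrow> (nat \<Rightarrow> 'a) \<Rightarrow> bool" where
  "cadmm_prox_run N f \<gamma> \<rho> z1 y1 l1 z \<longleftrightarrow>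
     (\<exists>(T :: nat \<Rightarrow> nat) (x :: nat \<Rightarrow> nat \<Rightarrow> 'a) (y :: nat \<Rightarrow> 'a) (l :: nat \<Rightarrow> nat \<Rightarrow> 'a).
        T 1 = 1 \<and> z 1 = z1 \<and> y 1 = y1 \<and> (\<forall>i\<in>{1..N}. l 1 i = l1 i) \<and>
        (\<forall>k\<ge>1.
           T k < T (k + 1) \<and>
           (\<forall>t\<in>{T k..<T (k + 1)}.
              cadmm_inner_step N f \<gamma> \<rho> (z k) (y t) (l t) (x (t + 1)) (y (t + 1)) (l (t + 1)) \<and>
              (stop_criterion N f \<gamma> (z k) (y (t + 1)) \<longleftrightarrow> t + 1 = T (k + 1))) \<and>
           z (k + 1) = y (T (k + 1))))"

end

theory Submission
  imports Defs
begin

text \<open>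
  Write \<open>F = f\<^sub>1 + \<dots> + f\<^sub>N\<close>. The stopping criterion that ends outer iteration \<open>k\<close> compares
  \<open>\<Phi>(z\<^sub>k, z\<^sub>k) = F(z\<^sub>k)\<close>, where the proximal term vanishes, with
  \<open>\<Phi>(z\<^sub>k, z\<^sub>k\<^sub>+\<^sub>1) = F(z\<^sub>k\<^sub>+\<^sub>1) + N \<gamma>/2 \<parallel>z\<^sub>k\<^sub>+\<^sub>1 - z\<^sub>k\<parallel>\<^sup>2\<close>. It is therefore a sufficient decrease
  condition: each outer step lowers \<open>F\<close> by at least a fixed multiple of its squared length
  (\<open>cadmm_prox_run_decrease\<close>). Since \<open>F\<close> is bounded below, the values \<open>F(z\<^sub>k)\<close> converge, so
  their consecutive differences tend to zero, and with them the step lengths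
  (\<open>sufficient_decrease_steps_tendsto_zero\<close>).
\<close>

text \<open>
  The values \<open>F(z\<^sub>k)\<close> decrease to a limit, and each squared step length is at most \<open>1/c\<close> times
  a difference of consecutive values.
\<close>

lemma sufficient_decrease_steps_tendsto_zero:
  fixes z :: "nat \<Rightarrow> 'a::metric_space" and F :: "'a \<Rightarrow> real"
  assumes "0 < c"
    and decrease: "\<And>k. F (z (Suc k)) + c * (dist (z (Suc k)) (z k))\<^sup>2 \<le> F (z k)"
    and lower: "\<And>k. B \<le> F (z k)"
  shows "(\<lambda>k. dist (z (Suc k)) (z k)) \<longlonglongrightarrow> 0"
proof -
  have step: "c * (dist (z (Suc k)) (z k))\<^sup>2 \<le> F (z k) - F (z (Suc k))" for k
    using decrease[of k] by linarith
  have "0 \<le> F (z k) - F (z (Suc k))" for k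
    by (rule order_trans[OF _ step]) (use \<open>0 < c\<close> in simp)
  then have "decseq (\<lambda>k. F (z k))"
    by (simp add: decseq_Suc_iff)
  then obtain L where L: "(\<lambda>k. F (z k)) \<longlonglongrightarrow> L"
    using decseq_convergent[OF \<open>decseq (\<lambda>k. F (z k))\<close> allI[OF lower]] by auto
  have gap: "(\<lambda>k. F (z k) - F (z (Suc k))) \<longlonglongrightarrow> 0"
    using tendsto_diff[OF L LIMSEQ_Suc[OF L]] by simp
  have "(\<lambda>k. c * (dist (z (Suc k)) (z k))\<^sup>2) \<longlonglongrightarrow> 0"
  proof (rule tendsto_sandwich[OF _ _ tendsto_const gap])
    show "\<forall>\<^sub>F k in sequentially. 0 \<le> c * (dist (z (Suc k)) (z k))\<^sup>2"
      using \<open>0 < c\<close> by simp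
    show "\<forall>\<^sub>F k in sequentially. c * (dist (z (Suc k)) (z k))\<^sup>2 \<le> F (z k) - F (z (Suc k))"
      using step by (intro always_eventually allI)
  qed
  from tendsto_mult_left[OF this, of "1 / c"]
  have "(\<lambda>k. (dist (z (Suc k)) (z k))\<^sup>2) \<longlonglongrightarrow> 0"
    using \<open>0 < c\<close> by simp
  from tendsto_real_sqrt[OF this] show ?thesis
    by simp
qed

lemma Phi_eq:
  "Phi N f \<gamma> z y = (\<Sum>i\<in>{1..N}. f i y) + real N * (\<gamma> / 2) * (norm (y - z))\<^sup>2"
  by (simp add: Phi_def prox_fun_def sum.distrib)

lemma cadmm_prox_run_decrease:
  assumes "cadmm_prox_run N f \<gamma> \<rho> z1 y1 l1 z" and "1 \<le> k"
  shows "(\<Sum>i\<in>{1..N}. f i (z (Suc k))) + real N * (\<gamma> / 2) * (norm (z (Suc k) - z k))\<^sup>2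
         \<le> (\<Sum>i\<in>{1..N}. f i (z k))"
proof -
  obtain T :: "nat \<Rightarrow> nat" and x y l where "\<forall>k\<ge>1. T k < T (k + 1) \<and>
      (\<forall>t\<in>{T k..<T (k + 1)}.
        cadmm_inner_step N f \<gamma> \<rho> (z k) (y t) (l t) (x (t + 1)) (y (t + 1)) (l (t + 1)) \<and>
        (stop_criterion N f \<gamma> (z k) (y (t + 1)) \<longleftrightarrow> t + 1 = T (k + 1))) \<and>
      z (k + 1) = y (T (k + 1))"
    using assms(1) unfolding cadmm_prox_run_def by (elim exE conjE) (erule that)
  with assms(2) have T: "T k < T (k + 1)"
    and stop: "\<forall>t\<in>{T k..<T (k + 1)}.
      stop_criterion N f \<gamma> (z k) (y (t + 1)) \<longleftrightarrow> t + 1 = T (k + 1)"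
    and z: "z (k + 1) = y (T (k + 1))"
    by simp_all
  \<comment> \<open>Outer iteration \<open>k\<close> has at least one inner iteration, so it has a last one, and the
      criterion holds there.\<close>
  have "stop_criterion N f \<gamma> (z k) (z (k + 1))"
    using bspec[OF stop, of "T (k + 1) - 1"] T z by simp
  then show ?thesis
    by (simp add: stop_criterion_def Phi_eq)
qed

theorem theorem1:
  fixes N :: nat and \<alpha> \<gamma> \<rho> :: real
    and f :: "nat \<Rightarrow> real ^ 'n \<Rightarrow> real"
    and z1 y1 :: "real ^ 'n" and l1 :: "nat \<Rightarrow> real ^ 'n"
    and z :: "nat \<Rightarrow> real ^ 'n"
  assumes "N \<ge> 1"
    and "0 < \<alpha>" and "\<alpha> < \<gamma>" and "0 < \<rho>"
    and "\<And>i. i \<in> {1..N} \<Longrightarrow> closed_fun (f i)"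
    and "\<And>i. i \<in> {1..N} \<Longrightarrow> proper_fun (\<lambda>x. ereal (f i x))"
    and "\<And>i. i \<in> {1..N} \<Longrightarrow> semi_convex \<alpha> (f i)"
    and "\<And>i. i \<in> {1..N} \<Longrightarrow> bdd_below (range (f i))"
    and "cadmm_prox_run N f \<gamma> \<rho> z1 y1 l1 z"
  shows "(\<lambda>k. norm (z (k + 1) - z k)) \<longlonglongrightarrow> 0"
proof -
  define F where "F v = (\<Sum>i\<in>{1..N}. f i v)" for v
  have lower: "(\<Sum>i\<in>{1..N}. INF u. f i u) \<le> F v" for v
    unfolding F_def by (intro sum_mono cINF_lower assms(8)) simp_all
  \<comment> \<open>The run starts at index 1, so the decrease principle is applied to the shifted sequence.\<close>
  have "(\<lambda>k. dist (z (Suc (Suc k))) (z (Suc k))) \<longlonglongrightarrow> 0"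
  proof (rule sufficient_decrease_steps_tendsto_zero[where z = "\<lambda>k. z (Suc k)"])
    show "0 < real N * (\<gamma> / 2)"
      using assms(1-3) by simp
    show "F (z (Suc (Suc k))) + real N * (\<gamma> / 2) * (dist (z (Suc (Suc k))) (z (Suc k)))\<^sup>2
          \<le> F (z (Suc k))" for k
      using cadmm_prox_run_decrease[OF assms(9), of "Suc k"] by (simp add: F_def dist_norm)
  qed (rule lower)
  then have "(\<lambda>k. dist (z (Suc k)) (z k)) \<longlonglongrightarrow> 0"
    by (rule LIMSEQ_imp_Suc)
  then show ?thesis
    by (simp add: dist_norm)
qed

end
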